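(* Let $k$ be a field, let $\mathfrak{g} \subseteq \mathfrak{h}$ be an extension of Lie algebras over $k$ (i.e. $\mathfrak{g}$ is a Lie subalgebra of $\mathfrak{h}$), let $p: \mathfrak{h} \to \mathfrak{g}$ be a linear retraction of the inclusion $\mathfrak{g} \subseteq \mathfrak{h}$ (i.e. $p$ is linear and $p(g)=g$ for all $g\in\mathfrak{g}$), and let $V = \ker(p)$. Let $\leftharpoonup$, $\rightharpoonup$, $\theta$, $\{-,-\}$ be the components of the canonical Lie extending system of $\mathfrak{g}$ through $V$ associated to $p$, and let $\mathbb{G}_{\mathfrak{g}}^V(\leftharpoonup,\rightharpoonup,\theta,\{-,-\})$ be the associated subgroup of $\mathrm{GL}_k(V)\rtimes \mathrm{Hom}_k(V,\mathfrak{g})$ (all defined in the context). Then the map $$\Omega: \mathbb{G}_{\mathfrak{g}}^V(\leftharpoonup,\rightharpoonup,\theta,\{-,-\}) \to \mathrm{Gal}(\mathfrak{h}/\mathfrak{g}), \qquad \Omega(\sigma, r)(g+x) := g + r(x) + \sigma(x),$$ for all $(\sigma,r)\in \mathbb{G}_{\mathfrak{g}}^V(\leftharpoonup,\rightharpoonup,\theta,\{-,-\})$, $g\in\mathfrak{g}$ and $x\in V$, is an isomorphism of groups. In particular, there exists an embedding of groups $\mathrm{Gal}(\mathfrak{h}/\mathfrak{g}) \hookrightarrow \mathrm{GL}_k(V)\rtimes \mathrm{Hom}_k(V,\mathfrak{g})$, where the right-hand side is the semidirect product associated to the canonical right action of $\mathrm{GL}_k(V)$ on $\mathrm{Hom}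_k(V,\mathfrak{g})$.
   Context: All vector spaces, (bi)linear maps and Lie algebras are over an arbitrary field $k$; no finite-dimensionality is assumed. Galois group: for an extension of Lie algebras $\mathfrak{g}\subseteq\mathfrak{h}$, $\mathrm{Gal}(\mathfrak{h}/\mathfrak{g}) := \{\sigma\in \mathrm{Aut}_{\mathrm{Lie}}(\mathfrak{h}) \mid \sigma(g)=g \text{ for all } g\in\mathfrak{g}\}$, a group under composition. Semidirect product: $\mathrm{GL}_k(V)$ is the group of linear automorphisms of $V$, acting on the right on the abelian group $(\mathrm{Hom}_k(V,\mathfrak{g}),+)$ of linear maps by $r\triangleleft\sigma := r\circ\sigma$. The semidirect product $\mathrm{GL}_k(V)\rtimes\mathrm{Hom}_k(V,\mathfrak{g})$ is the set $\mathrm{GL}_k(V)\times\mathrm{Hom}_k(V,\mathfrak{g})$ with multiplication $(\sigma,r)\cdot(\sigma',r') := (\sigma\circ\sigma',\, r\circ\sigma' + r')$. Canonical Lie extending system associated to $p$: since $p$ is a retraction, $\mathfrak{h}=\mathfrak{g}\oplus V$ as vector spaces. The bilinear maps $\rightharpoonup: V\times\mathfrak{g}\to\mathfrak{g}$, $\leftharpoonup: V\times\mathfrak{g}\to V$, $\theta: V\times V\to\mathfrak{g}$, $\{-,-\}: V\times V\to V$ are given, for $g\in\mathfrak{g}$ and $x,y\in V$, by $$x\rightharpoonup g := p([x,g]),\quad x\leftharpoonup g := [x,g]-p([x,g]),\quad \theta(x,y):=p([x,y]),\quad \{x,y\}:=[x,y]-p([x,y]).$$ The group $\mathbb{G}_{\mathfrak{g}}^V(\leftharpoonup,\rightharpoonup,\theta,\{-,-\})$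 is the set of all pairs $(\sigma,r)\in\mathrm{GL}_k(V)\times\mathrm{Hom}_k(V,\mathfrak{g})$ such that for all $g\in\mathfrak{g}$, $x,y\in V$: (G1) $\sigma(x\leftharpoonup g)=\sigma(x)\leftharpoonup g$; (G2) $r(x\leftharpoonup g)=[r(x),g]+(\sigma(x)-x)\rightharpoonup g$; (G3) $\sigma(\{x,y\})=\{\sigma(x),\sigma(y)\}+\sigma(x)\leftharpoonup r(y)-\sigma(y)\leftharpoonup r(x)$; (G4) $r(\{x,y\})=[r(x),r(y)]+\sigma(x)\rightharpoonup r(y)-\sigma(y)\rightharpoonup r(x)+\theta(\sigma(x),\sigma(y))-\theta(x,y)$. It is a subgroup of $\mathrm{GL}_k(V)\rtimes\mathrm{Hom}_k(V,\mathfrak{g})$, with the multiplication above. *)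

theory Defs
  imports Complex_Main "HOL-Algebra.Bij"
begin

section \<open>Lie algebras and Lie subalgebras\<close>

text \<open>
  The ambient Lie algebra is a whole type with explicit scalar multiplication and bracket;
  Lie subalgebras and linear subspaces of it are sets.
\<close>

locale lie_algebra = vector_space scale
  for scale :: "'k::field \<Rightarrow> 'h::ab_group_add \<Rightarrow> 'h" +
  fixes bracket :: "'h \<Rightarrow> 'h \<Rightarrow> 'h"
  assumes linear_bracket_left: "\<And>y. Vector_Spaces.linear scale scale (\<lambda>x. bracket x y)"
    and linear_bracket_right: "\<And>x. Vector_Spaces.linear scale scale (\<lambda>y. bracket x y)"
    and bracket_self: "\<And>x. bracket x x = 0"
    and jacobi: "\<And>x y z. bracket x (bracket y z) + bracket y (bracket z x) + bracket z (bracket x y) = 0"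

definition lie_subalgebra ::
  "('k::field \<Rightarrow> 'h::ab_group_add \<Rightarrow> 'h) \<Rightarrow> ('h \<Rightarrow> 'h \<Rightarrow> 'h) \<Rightarrow> 'h set \<Rightarrow> bool" where
  "lie_subalgebra scale bracket \<gg> \<longleftrightarrow>
     module.subspace scale \<gg> \<and> (\<forall>x\<in>\<gg>. \<forall>y\<in>\<gg>. bracket x y \<in> \<gg>)"

definition linear_retraction ::
  "('k::field \<Rightarrow> 'h::ab_group_add \<Rightarrow> 'h) \<Rightarrow> 'h set \<Rightarrow> ('h \<Rightarrow> 'h) \<Rightarrow> bool" where
  "linear_retraction scale \<gg> p \<longleftrightarrow>
     Vector_Spaces.linear scale scale p \<and> (\<forall>h. p h \<in> \<gg>) \<and> (\<forall>g\<in>\<gg>. p g = g)"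


section \<open>The Galois group\<close>

definition lie_automorphism ::
  "('k::field \<Rightarrow> 'h::ab_group_add \<Rightarrow> 'h) \<Rightarrow> ('h \<Rightarrow> 'h \<Rightarrow> 'h) \<Rightarrow> ('h \<Rightarrow> 'h) \<Rightarrow> bool" where
  "lie_automorphism scale bracket \<sigma> \<longleftrightarrow>
     Vector_Spaces.linear scale scale \<sigma> \<and> bij \<sigma> \<and>
     (\<forall>x y. \<sigma> (bracket x y) = bracket (\<sigma> x) (\<sigma> y))"

definition Gal ::
  "('k::field \<Rightarrow> 'h::ab_group_add \<Rightarrow> 'h) \<Rightarrow> ('h \<Rightarrow> 'h \<Rightarrow> 'h) \<Rightarrow> 'h set \<Rightarrow> ('h \<Rightarrow> 'h) monoid" where
  "Gal scale bracket \<gg> =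
     (BijGroup UNIV)
       \<lparr>carrier := {\<sigma>. lie_automorphism scale bracket \<sigma> \<and> (\<forall>g\<in>\<gg>. \<sigma> g = g)}\<rparr>"


section \<open>The semidirect product\<close>

text \<open>
  Linear maps with domain a proper subspace \<^term>\<open>V\<close> are represented by functions that are
  \<^const>\<open>undefined\<close> outside \<^term>\<open>V\<close>, so that equality of functions is equality on
  \<^term>\<open>V\<close>.
\<close>

definition linear_on ::
  "('k::field \<Rightarrow> 'h::ab_group_add \<Rightarrow> 'h) \<Rightarrow> 'h set \<Rightarrow> ('h \<Rightarrow> 'h) \<Rightarrow> bool" where
  "linear_on scale V f \<longleftrightarrow>
     (\<forall>x\<in>V. \<forall>y\<in>V. f (x + y) = f x + f y) \<and> (\<forall>c. \<forall>x\<in>V. f (scale c x) = scale c (f x))"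

definition GL_group ::
  "('k::field \<Rightarrow> 'h::ab_group_add \<Rightarrow> 'h) \<Rightarrow> 'h set \<Rightarrow> ('h \<Rightarrow> 'h) monoid" where
  "GL_group scale V = (BijGroup V)\<lparr>carrier := {\<sigma> \<in> Bij V. linear_on scale V \<sigma>}\<rparr>"

definition Hom_group ::
  "('k::field \<Rightarrow> 'h::ab_group_add \<Rightarrow> 'h) \<Rightarrow> 'h set \<Rightarrow> 'h set \<Rightarrow> ('h \<Rightarrow> 'h) monoid" where
  "Hom_group scale V \<gg> =
     \<lparr>carrier = {r \<in> V \<rightarrow>\<^sub>E \<gg>. linear_on scale V r},
      mult = \<lambda>r s. \<lambda>x\<in>V. r x + s x,
      one = \<lambda>x\<in>V. 0\<rparr>"

text \<open>For a right action \<^term>\<open>act h g\<close> of \<^term>\<open>G\<close> on \<^term>\<open>H\<close> by group automorphisms.\<close>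

definition right_semidirect ::
  "'a monoid \<Rightarrow> 'b monoid \<Rightarrow> ('b \<Rightarrow> 'a \<Rightarrow> 'b) \<Rightarrow> ('a \<times> 'b) monoid" where
  "right_semidirect G H act =
     \<lparr>carrier = carrier G \<times> carrier H,
      mult = \<lambda>(g, h) (g', h'). (g \<otimes>\<^bsub>G\<^esub> g', act h g' \<otimes>\<^bsub>H\<^esub> h'),
      one = (\<one>\<^bsub>G\<^esub>, \<one>\<^bsub>H\<^esub>)\<rparr>"

definition GL_Hom ::
  "('k::field \<Rightarrow> 'h::ab_group_add \<Rightarrow> 'h) \<Rightarrow> 'h set \<Rightarrow> 'h set
     \<Rightarrow> (('h \<Rightarrow> 'h) \<times> ('h \<Rightarrow> 'h)) monoid" where
  "GL_Hom scale V \<gg> =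
     right_semidirect (GL_group scale V) (Hom_group scale V \<gg>) (\<lambda>r \<sigma>. compose V r \<sigma>)"


section \<open>The canonical Lie extending system and its group\<close>

definition can_rharp :: "('h \<Rightarrow> 'h \<Rightarrow> 'h) \<Rightarrow> ('h \<Rightarrow> 'h) \<Rightarrow> 'h \<Rightarrow> 'h \<Rightarrow> 'h" where
  "can_rharp bracket p x g = p (bracket x g)"

definition can_lharp ::
  "('h::ab_group_add \<Rightarrow> 'h \<Rightarrow> 'h) \<Rightarrow> ('h \<Rightarrow> 'h) \<Rightarrow> 'h \<Rightarrow> 'h \<Rightarrow> 'h" where
  "can_lharp bracket p x g = bracket x g - p (bracket x g)"

definition can_theta :: "('h \<Rightarrow> 'h \<Rightarrow> 'h) \<Rightarrow> ('h \<Rightarrow> 'h) \<Rightarrow> 'h \<Rightarrow> 'h \<Rightarrow> 'h" where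
  "can_theta bracket p x y = p (bracket x y)"

definition can_curly ::
  "('h::ab_group_add \<Rightarrow> 'h \<Rightarrow> 'h) \<Rightarrow> ('h \<Rightarrow> 'h) \<Rightarrow> 'h \<Rightarrow> 'h \<Rightarrow> 'h" where
  "can_curly bracket p x y = bracket x y - p (bracket x y)"

definition extending_group ::
  "('k::field \<Rightarrow> 'h::ab_group_add \<Rightarrow> 'h) \<Rightarrow> ('h \<Rightarrow> 'h \<Rightarrow> 'h) \<Rightarrow> 'h set \<Rightarrow> 'h set
     \<Rightarrow> ('h \<Rightarrow> 'h \<Rightarrow> 'h) \<Rightarrow> ('h \<Rightarrow> 'h \<Rightarrow> 'h) \<Rightarrow> ('h \<Rightarrow> 'h \<Rightarrow> 'h) \<Rightarrow> ('h \<Rightarrow> 'h \<Rightarrow> 'h)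
     \<Rightarrow> (('h \<Rightarrow> 'h) \<times> ('h \<Rightarrow> 'h)) monoid" where
  "extending_group scale bracket \<gg> V lharp rharp \<theta> curly =
     (GL_Hom scale V \<gg>)\<lparr>carrier :=
       {(\<sigma>, r) \<in> carrier (GL_group scale V) \<times> carrier (Hom_group scale V \<gg>).
          (\<forall>x\<in>V. \<forall>g\<in>\<gg>. \<sigma> (lharp x g) = lharp (\<sigma> x) g) \<and>
          (\<forall>x\<in>V. \<forall>g\<in>\<gg>. r (lharp x g) = bracket (r x) g + rharp (\<sigma> x - x) g) \<and>
          (\<forall>x\<in>V. \<forall>y\<in>V. \<sigma> (curly x y) =
              curly (\<sigma> x) (\<sigma> y) + lharp (\<sigma> x) (r y) - lharp (\<sigma> y) (r x)) \<and>
          (\<forall>x\<in>V. \<forall>y\<in>V. r (curly x y) =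
              bracket (r x) (r y) + rharp (\<sigma> x) (r y) - rharp (\<sigma> y) (r x)
              + \<theta> (\<sigma> x) (\<sigma> y) - \<theta> x y)}\<rparr>"

text \<open>
  The decomposition of \<^term>\<open>h\<close> as \<open>g + x\<close> with \<open>g \<in> \<gg>\<close> and \<open>x \<in> ker p\<close> has
  \<open>g = p h\<close> and \<open>x = h - p h\<close>.
\<close>

definition Omega ::
  "('h::ab_group_add \<Rightarrow> 'h) \<Rightarrow> ('h \<Rightarrow> 'h) \<times> ('h \<Rightarrow> 'h) \<Rightarrow> 'h \<Rightarrow> 'h" where
  "Omega p = (\<lambda>(\<sigma>, r) h. p h + r (h - p h) + \<sigma> (h - p h))"

end

theory Submission
  imports Defs
begin

text \<open>
  Since \<open>\<hh> = \<gg> \<oplus> V\<close>, the map \<^const>\<open>Omega\<close> identifies the whole semidirect product with the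
  group of linear automorphisms \<open>f\<close> of \<open>\<hh>\<close> that fix \<open>\<gg>\<close> pointwise and induce an automorphism
  of \<open>\<hh> / \<gg>\<close>; such an \<open>f\<close> comes from \<open>\<sigma> = (id - p) \<circ> f\<close> and \<open>r = p \<circ> f\<close> on \<open>V\<close>. Comparing
  \<open>\<gg>\<close>- and \<open>V\<close>-components of \<open>f [u, v] = [f u, f v]\<close> on \<open>V \<times> \<gg>\<close> and on \<open>V \<times> V\<close> yields exactly
  the four conditions (G1)-(G4), so that the extending group is the preimage of the Galois group.
\<close>

section \<open>Right semidirect products and preimages of subgroups\<close>

text \<open>Associativity in the second component combines \<open>act_mult\<close> with
  \<open>act_comp\<close>: both bracketings become \<open>act h (g' g'')\<close> times
  \<open>act h' g''\<close> times \<open>h''\<close>.\<close>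

lemma group_right_semidirect:
  fixes G :: "'a monoid" and H :: "'b monoid"
  assumes "group G" and "group H"
    and closed: "\<And>h g. \<lbrakk>h \<in> carrier H; g \<in> carrier G\<rbrakk> \<Longrightarrow> act h g \<in> carrier H"
    and act_mult: "\<And>h h' g. \<lbrakk>h \<in> carrier H; h' \<in> carrier H; g \<in> carrier G\<rbrakk>
      \<Longrightarrow> act (h \<otimes>\<^bsub>H\<^esub> h') g = act h g \<otimes>\<^bsub>H\<^esub> act h' g"
    and act_comp: "\<And>h g g'. \<lbrakk>h \<in> carrier H; g \<in> carrier G; g' \<in> carrier G\<rbrakk>
      \<Longrightarrow> act h (g \<otimes>\<^bsub>G\<^esub> g') = act (act h g) g'"
    and act_one: "\<And>h. h \<in> carrier H \<Longrightarrow> act h \<one>\<^bsub>G\<^esub> = h"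
  shows "group (right_semidirect G H act)"
proof -
  interpret G: group G by fact
  interpret H: group H by fact
  \<comment> \<open>An idempotent of a group is its unit. This yields the left unit law.\<close>
  have one_act: "act \<one>\<^bsub>H\<^esub> g = \<one>\<^bsub>H\<^esub>" if "g \<in> carrier G" for g
  proof -
    have "act \<one>\<^bsub>H\<^esub> g = act \<one>\<^bsub>H\<^esub> g \<otimes>\<^bsub>H\<^esub> act \<one>\<^bsub>H\<^esub> g"
      using act_mult[of "\<one>\<^bsub>H\<^esub>" "\<one>\<^bsub>H\<^esub>" g] that by simp
    then show ?thesis
      using closed[OF H.one_closed that] by (simp only: H.l_cancel_one')
  qed
  show ?thesis
  proof (rule groupI)
    fix x y z
    assume "x \<in> carrier (right_semidirect G H act)" "y \<in> carrier (right_semidirect G H act)"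
      "z \<in> carrier (right_semidirect G H act)"
    then show "x \<otimes>\<^bsub>right_semidirect G H act\<^esub> y \<otimes>\<^bsub>right_semidirect G H act\<^esub> z =
      x \<otimes>\<^bsub>right_semidirect G H act\<^esub> (y \<otimes>\<^bsub>right_semidirect G H act\<^esub> z)"
      by (auto simp: right_semidirect_def G.m_assoc H.m_assoc act_mult act_comp closed)
  next
    fix x
    assume "x \<in> carrier (right_semidirect G H act)"
    then obtain g h where x: "x = (g, h)" "g \<in> carrier G" "h \<in> carrier H"
      by (auto simp: right_semidirect_def)
    \<comment> \<open>In a left inverse \<open>(inv g, k)\<close> of \<open>(g, h)\<close> the
      second component must satisfy \<open>act k g = inv h\<close>; undoing the action of
      \<open>g\<close> gives \<open>k\<close>.\<close>
    have "act (act (inv\<^bsub>H\<^esub> h) (inv\<^bsub>G\<^esub> g)) g = inv\<^bsub>H\<^esub> h"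
      using x act_comp[of "inv\<^bsub>H\<^esub> h" "inv\<^bsub>G\<^esub> g" g] by (simp add: act_one)
    then show "\<exists>y\<in>carrier (right_semidirect G H act).
        y \<otimes>\<^bsub>right_semidirect G H act\<^esub> x = \<one>\<^bsub>right_semidirect G H act\<^esub>"
      using x closed[of "inv\<^bsub>H\<^esub> h" "inv\<^bsub>G\<^esub> g"]
      by (intro bexI[of _ "(inv\<^bsub>G\<^esub> g, act (inv\<^bsub>H\<^esub> h) (inv\<^bsub>G\<^esub> g))"])
        (auto simp: right_semidirect_def)
  qed (auto simp: right_semidirect_def closed one_act)
qed

text \<open>Serves to pull the Galois group back along \<open>Omega p\<close>, so that closure of
  (G1)-(G4) under products and inverses follows without manipulating these equations.\<close>

lemma (in group_hom) subgroup_preimage: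
  assumes "subgroup K H"
  shows "subgroup {x \<in> carrier G. h x \<in> K} G"
proof -
  interpret K: subgroup K H by fact
  show ?thesis
    by (rule subgroup.intro) (auto intro: K.m_closed K.m_inv_closed)
qed

lemma mult_BijGroup:
  "\<lbrakk>f \<in> Bij V; g \<in> Bij V\<rbrakk> \<Longrightarrow> f \<otimes>\<^bsub>BijGroup V\<^esub> g = compose V f g"
  by (simp add: BijGroup_def)

lemma Bij_UNIV: "f \<in> Bij UNIV \<longleftrightarrow> bij f"
  by (simp add: Bij_def)

section \<open>Linear bijections and linear maps on subspaces\<close>

context vector_space
begin

lemma linear_iff_linear_on: "Vector_Spaces.linear scale scale f \<longleftrightarrow> linear_on scale UNIV f"
  by (auto simp: Vector_Spaces.linear_iff linear_on_def vector_space_axioms)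

lemma linear_on_zero:
  assumes "linear_on scale V f" and "subspace V"
  shows "f 0 = 0"
proof -
  have "f (scale 0 0) = scale 0 (f 0)"
    using assms subspace_0 unfolding linear_on_def by blast
  then show ?thesis by simp
qed

text \<open>Used twice: for the kernel of \<open>p\<close> it gives the general linear group, and
  for \<open>UNIV\<close> it supplies the linear part of the Galois group.\<close>

lemma subgroup_linear_Bij:
  assumes V: "subspace V"
  shows "subgroup {\<sigma> \<in> Bij V. linear_on scale V \<sigma>} (BijGroup V)"
proof -
  have mem: "\<sigma> x \<in> V" if "\<sigma> \<in> Bij V" "x \<in> V" for \<sigma> x
    using Bij_imp_funcset that by blast
  show ?thesis
  proof (rule subgroup.intro)
    show "{\<sigma> \<in> Bij V. linear_on scale V \<sigma>} \<subseteq> carrier (BijGroup V)"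
      by (auto simp: BijGroup_def)
    show "\<one>\<^bsub>BijGroup V\<^esub> \<in> {\<sigma> \<in> Bij V. linear_on scale V \<sigma>}"
      using V by (auto simp: BijGroup_def id_Bij linear_on_def subspace_add subspace_scale)
  next
    fix \<sigma> \<tau>
    assume "\<sigma> \<in> {\<sigma> \<in> Bij V. linear_on scale V \<sigma>}" "\<tau> \<in> {\<sigma> \<in> Bij V. linear_on scale V \<sigma>}"
    then show "\<sigma> \<otimes>\<^bsub>BijGroup V\<^esub> \<tau> \<in> {\<sigma> \<in> Bij V. linear_on scale V \<sigma>}"
      using V by (auto simp: mult_BijGroup compose_Bij linear_on_def subspace_add subspace_scale
          compose_eq mem)
  next
    fix \<sigma>
    assume "\<sigma> \<in> {\<sigma> \<in> Bij V. linear_on scale V \<sigma>}"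
    then have \<sigma>: "\<sigma> \<in> Bij V" and lin: "linear_on scale V \<sigma>" by auto
    have "inv_into V \<sigma> (x + y) = inv_into V \<sigma> x + inv_into V \<sigma> y" if "x \<in> V" "y \<in> V" for x y
      using lin V by (intro Bij_inv_into_lemma[OF _ \<sigma> _ that])
        (auto simp: linear_on_def subspace_add)
    \<comment> \<open>\<open>Bij_inv_into_lemma\<close> is about binary operations, so scaling by
      \<open>c\<close> is presented as one that ignores its first argument.\<close>
    moreover have "inv_into V \<sigma> (scale c x) = scale c (inv_into V \<sigma> x)" if "x \<in> V" for c x
      using lin V by (intro Bij_inv_into_lemma[where g = "\<lambda>_. scale c", OF _ \<sigma> _ that that])
        (auto simp: linear_on_def subspace_scale)
    ultimately show "inv\<^bsub>BijGroup V\<^esub> \<sigma> \<in> {\<sigma> \<in> Bij V. linear_on scale V \<sigma>}"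
      using V by (simp add: inv_BijGroup[OF \<sigma>] restrict_inv_into_Bij[OF \<sigma>] linear_on_def
          subspace_add subspace_scale)
  qed
qed

lemma group_GL_group:
  assumes "subspace V"
  shows "group (GL_group scale V)"
  unfolding GL_group_def
  using subgroup_linear_Bij[OF assms] group_BijGroup by (rule subgroup.subgroup_is_group)

lemma group_Hom_group:
  assumes V: "subspace V" and W: "subspace W"
  shows "group (Hom_group scale V W)"
proof (rule groupI)
  have mem: "r x \<in> W" if "r \<in> V \<rightarrow>\<^sub>E W" "x \<in> V" for r x
    using that by auto
  show "r \<otimes>\<^bsub>Hom_group scale V W\<^esub> s \<in> carrier (Hom_group scale V W)"
    if "r \<in> carrier (Hom_group scale V W)" "s \<in> carrier (Hom_group scale V W)" for r s
    using that V W
    by (auto simp: Hom_group_def linear_on_def subspace_add subspace_scale mem algebra_simps)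
  fix r assume r: "r \<in> carrier (Hom_group scale V W)"
  show "\<exists>s\<in>carrier (Hom_group scale V W). s \<otimes>\<^bsub>Hom_group scale V W\<^esub> r = \<one>\<^bsub>Hom_group scale V W\<^esub>"
  proof (rule bexI[of _ "\<lambda>x\<in>V. - r x"])
    show "(\<lambda>x\<in>V. - r x) \<in> carrier (Hom_group scale V W)"
      using r V W
      by (auto simp: Hom_group_def linear_on_def subspace_add subspace_scale subspace_neg mem)
  qed (auto simp: Hom_group_def)
  show "\<one>\<^bsub>Hom_group scale V W\<^esub> \<otimes>\<^bsub>Hom_group scale V W\<^esub> r = r"
    using r by (auto simp: Hom_group_def PiE_def extensional_def fun_eq_iff)
qed (use V W in \<open>auto simp: Hom_group_def linear_on_def subspace_add subspace_scale subspace_0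
      algebra_simps intro!: restrict_ext\<close>)

text \<open>Precomposition is additive in \<open>r\<close>, and associativity of composition makes
  it a right action. Since \<open>compose V\<close> restricts to \<open>V\<close> and the maps
  \<open>r\<close> are extensional, the unit acts trivially.\<close>

lemma group_GL_Hom:
  assumes V: "subspace V" and W: "subspace W"
  shows "group (GL_Hom scale V W)"
  unfolding GL_Hom_def
proof (rule group_right_semidirect)
  show "group (GL_group scale V)" "group (Hom_group scale V W)"
    using V W by (simp_all add: group_GL_group group_Hom_group)
  have mem: "\<sigma> x \<in> V" if "\<sigma> \<in> Bij V" "x \<in> V" for \<sigma> x
    using Bij_imp_funcset that by blast
  show "compose V r \<sigma> \<in> carrier (Hom_group scale V W)"
    if "r \<in> carrier (Hom_group scale V W)" "\<sigma> \<in> carrier (GL_group scale V)" for r \<sigma>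
    using that V
    by (auto simp: Hom_group_def GL_group_def linear_on_def compose_def subspace_add
        subspace_scale mem PiE_mem)
  show "compose V (r \<otimes>\<^bsub>Hom_group scale V W\<^esub> s) \<sigma> =
      compose V r \<sigma> \<otimes>\<^bsub>Hom_group scale V W\<^esub> compose V s \<sigma>"
    if "\<sigma> \<in> carrier (GL_group scale V)" for r s \<sigma>
    using that by (auto simp: Hom_group_def GL_group_def compose_def mem intro!: restrict_ext)
  show "compose V r (\<sigma> \<otimes>\<^bsub>GL_group scale V\<^esub> \<tau>) = compose V (compose V r \<sigma>) \<tau>"
    if "\<sigma> \<in> carrier (GL_group scale V)" "\<tau> \<in> carrier (GL_group scale V)" for r \<sigma> \<tau>
    using that by (auto simp: GL_group_def mult_BijGroup compose_def mem intro!: restrict_ext)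
  show "compose V r \<one>\<^bsub>GL_group scale V\<^esub> = r"
    if "r \<in> carrier (Hom_group scale V W)" for r
    using that by (auto simp: GL_group_def BijGroup_def Hom_group_def PiE_def)
qed

end

section \<open>Bracket identities and the Galois group\<close>

context lie_algebra
begin

lemma bracket_add_left: "bracket (x + y) z = bracket x z + bracket y z"
  using linear_bracket_left by (auto simp: Vector_Spaces.linear_iff)

lemma bracket_add_right: "bracket z (x + y) = bracket z x + bracket z y"
  using linear_bracket_right by (auto simp: Vector_Spaces.linear_iff)

lemma bracket_diff_left: "bracket (x - y) z = bracket x z - bracket y z"
  using bracket_add_left[of "x - y" y z] by (simp add: algebra_simps)

text \<open>Polarisation of \<open>bracket_self\<close>, valid in every characteristic.\<close>

lemma bracket_antisym: "bracket x y = - bracket y x"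
proof -
  have "bracket x y + bracket y x = bracket (x + y) (x + y)"
    unfolding bracket_add_left bracket_add_right by (simp add: bracket_self add.commute)
  then show ?thesis by (simp add: bracket_self eq_neg_iff_add_eq_0)
qed

lemma subgroup_Gal:
  "subgroup {\<sigma>. lie_automorphism scale bracket \<sigma> \<and> (\<forall>g\<in>\<gg>. \<sigma> g = g)} (BijGroup UNIV)"
    (is "subgroup ?A _")
proof -
  interpret L: subgroup "{\<sigma> \<in> Bij UNIV. linear_on scale UNIV \<sigma>}" "BijGroup UNIV"
    by (rule subgroup_linear_Bij) simp
  \<comment> \<open>Separates the linear bijections, whose closure properties come from
    \<open>L\<close>, from the two conditions that remain to be checked.\<close>
  have A: "\<sigma> \<in> ?A \<longleftrightarrow> \<sigma> \<in> {\<sigma> \<in> Bij UNIV. linear_on scale UNIV \<sigma>} \<and>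
      (\<forall>x y. \<sigma> (bracket x y) = bracket (\<sigma> x) (\<sigma> y)) \<and> (\<forall>g\<in>\<gg>. \<sigma> g = g)" for \<sigma>
    by (auto simp: lie_automorphism_def linear_iff_linear_on Bij_UNIV)
  show ?thesis
  proof (rule subgroup.intro)
    show "?A \<subseteq> carrier (BijGroup UNIV)"
      using L.subset A by blast
    show "\<one>\<^bsub>BijGroup UNIV\<^esub> \<in> ?A"
      unfolding A using L.one_closed by (simp add: BijGroup_def)
  next
    fix \<sigma> \<tau>
    assume *: "\<sigma> \<in> ?A" "\<tau> \<in> ?A"
    then have "\<sigma> \<otimes>\<^bsub>BijGroup UNIV\<^esub> \<tau> = \<sigma> \<circ> \<tau>"
      unfolding A by (auto simp: mult_BijGroup compose_def fun_eq_iff)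
    with * show "\<sigma> \<otimes>\<^bsub>BijGroup UNIV\<^esub> \<tau> \<in> ?A"
      unfolding A using L.m_closed[of \<sigma> \<tau>] by simp
  next
    fix \<sigma>
    assume *: "\<sigma> \<in> ?A"
    then have "bij \<sigma>" by (simp add: lie_automorphism_def)
    have "inv\<^bsub>BijGroup UNIV\<^esub> \<sigma> = inv_into UNIV \<sigma>"
      using \<open>bij \<sigma>\<close> by (simp add: inv_BijGroup Bij_UNIV restrict_def)
    \<comment> \<open>By injectivity it suffices to compare both sides after applying
      \<open>\<sigma>\<close>.\<close>
    moreover have "inv_into UNIV \<sigma> (bracket x y) = bracket (inv_into UNIV \<sigma> x) (inv_into UNIV \<sigma> y)" for x y
      using * \<open>bij \<sigma>\<close> by (intro inv_f_eq) (auto simp: lie_automorphism_def bij_def surj_f_inv_f)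
    moreover have "inv_into UNIV \<sigma> g = g" if "g \<in> \<gg>" for g
      using * \<open>bij \<sigma>\<close> that by (intro inv_f_eq) (auto simp: A bij_def)
    ultimately show "inv\<^bsub>BijGroup UNIV\<^esub> \<sigma> \<in> ?A"
      using * L.m_inv_closed[of \<sigma>] unfolding A by simp
  qed
qed

lemma group_Gal: "group (Gal scale bracket \<gg>)"
  unfolding Gal_def using subgroup_Gal group_BijGroup by (rule subgroup.subgroup_is_group)

end

section \<open>The decomposition of the ambient algebra induced by the retraction\<close>

locale retracted_lie_extension = lie_algebra +
  fixes \<gg> :: "'b set" and p :: "'b \<Rightarrow> 'b"
  assumes subalgebra: "lie_subalgebra scale bracket \<gg>"
    and retraction: "linear_retraction scale \<gg> p"
begin

definition complement :: "'b set" where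
  "complement = {x. p x = 0}"

lemma p_add [simp]: "p (x + y) = p x + p y"
  and p_scale [simp]: "p (scale c x) = scale c (p x)"
  and p_mem [simp]: "p x \<in> \<gg>"
  and p_fix [simp]: "g \<in> \<gg> \<Longrightarrow> p g = g"
  using retraction by (auto simp: linear_retraction_def Vector_Spaces.linear_iff)

lemma p_zero [simp]: "p 0 = 0"
  using p_add[of 0 0] by simp

lemma p_diff [simp]: "p (x - y) = p x - p y"
  using p_add[of "x - y" y] by (simp add: algebra_simps)

lemma subspace_subalgebra: "subspace \<gg>"
  and add_mem [simp]: "\<lbrakk>x \<in> \<gg>; y \<in> \<gg>\<rbrakk> \<Longrightarrow> x + y \<in> \<gg>"
  and diff_mem [simp]: "\<lbrakk>x \<in> \<gg>; y \<in> \<gg>\<rbrakk> \<Longrightarrow> x - y \<in> \<gg>"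
  and bracket_mem [simp]: "\<lbrakk>x \<in> \<gg>; y \<in> \<gg>\<rbrakk> \<Longrightarrow> bracket x y \<in> \<gg>"
  using subalgebra by (auto simp: lie_subalgebra_def subspace_add subspace_diff)

lemma subspace_complement: "subspace complement"
  by (simp add: subspace_def complement_def)

lemma minus_p_mem [simp]: "x - p x \<in> complement"
  by (simp add: complement_def)

lemma lharp_mem [simp]: "can_lharp bracket p x g \<in> complement"
  and curly_mem [simp]: "can_curly bracket p x y \<in> complement"
  by (simp_all add: can_lharp_def can_curly_def)

lemma p_complement [simp]: "x \<in> complement \<Longrightarrow> p x = 0"
  by (simp add: complement_def)

text \<open>The retraction is the identity on \<open>\<gg>\<close> and vanishes on
  \<open>complement\<close>, so applying it isolates the first summands. This splits one equation in
  the ambient algebra into its two components.\<close>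

lemma components_eq_iff:
  assumes "a \<in> \<gg>" "b \<in> \<gg>" "x \<in> complement" "y \<in> complement"
  shows "a + x = b + y \<longleftrightarrow> a = b \<and> x = y"
proof
  assume *: "a + x = b + y"
  have "a = b" using arg_cong[OF *, of p] assms by simp
  with * show "a = b \<and> x = y" by simp
qed simp

lemma mem_GL_Hom_iff:
  "(\<sigma>, r) \<in> carrier (GL_Hom scale complement \<gg>) \<longleftrightarrow>
     \<sigma> \<in> Bij complement \<and> linear_on scale complement \<sigma> \<and>
     r \<in> complement \<rightarrow>\<^sub>E \<gg> \<and> linear_on scale complement r"
  by (auto simp: GL_Hom_def right_semidirect_def GL_group_def Hom_group_def)

lemma mult_GL_Hom:
  assumes "(\<sigma>, r) \<in> carrier (GL_Hom scale complement \<gg>)"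
    and "(\<tau>, s) \<in> carrier (GL_Hom scale complement \<gg>)"
  shows "(\<sigma>, r) \<otimes>\<^bsub>GL_Hom scale complement \<gg>\<^esub> (\<tau>, s) =
    (compose complement \<sigma> \<tau>, \<lambda>x\<in>complement. r (\<tau> x) + s x)"
  using assms
  by (auto simp: mem_GL_Hom_iff GL_Hom_def right_semidirect_def GL_group_def
      Hom_group_def mult_BijGroup compose_eq intro!: restrict_ext)

lemma Omega_add:
  assumes "g \<in> \<gg>" "x \<in> complement"
  shows "Omega p (\<sigma>, r) (g + x) = g + r x + \<sigma> x"
  using assms by (simp add: Omega_def)

lemma group_semidirect: "group (GL_Hom scale complement \<gg>)"
  by (rule group_GL_Hom[OF subspace_complement subspace_subalgebra])

section \<open>The map \<open>Omega\<close> at a fixed pair of the semidirect product\<close>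

context
  fixes \<sigma> r
  assumes mem: "(\<sigma>, r) \<in> carrier (GL_Hom scale complement \<gg>)"
begin

lemma sigma_mem [simp]: "x \<in> complement \<Longrightarrow> \<sigma> x \<in> complement"
  using mem Bij_imp_funcset by (auto simp: mem_GL_Hom_iff)

lemma r_mem [simp]: "x \<in> complement \<Longrightarrow> r x \<in> \<gg>"
  using mem by (auto simp: mem_GL_Hom_iff)

lemma Omega_complement: "x \<in> complement \<Longrightarrow> Omega p (\<sigma>, r) x = r x + \<sigma> x"
  by (simp add: Omega_def)

lemma linear_Omega: "Vector_Spaces.linear scale scale (Omega p (\<sigma>, r))"
proof -
  \<comment> \<open>Here \<open>f\<close> stands for both \<open>\<sigma>\<close> and
    \<open>r\<close>. They are linear only on \<open>complement\<close>, so the argument is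
    regrouped into summands lying there.\<close>
  have "f (x + y - p (x + y)) = f (x - p x) + f (y - p y)"
    if "linear_on scale complement f" for f x y
  proof -
    have "x + y - p (x + y) = (x - p x) + (y - p y)" by simp
    then show ?thesis
      using that minus_p_mem unfolding linear_on_def by (simp only:)
  qed
  moreover have "f (scale c x - p (scale c x)) = scale c (f (x - p x))"
    if "linear_on scale complement f" for f x c
  proof -
    have "scale c x - p (scale c x) = scale c (x - p x)" by (simp add: scale_right_diff_distrib)
    then show ?thesis
      using that minus_p_mem unfolding linear_on_def by (simp only:)
  qed
  ultimately show ?thesis
    using mem
    \<comment> \<open>Unfolding \<open>linear_on\<close> only at \<open>UNIV\<close> and withholding
      \<open>p_add\<close> and \<open>p_scale\<close> lets the two facts above match as rewrite
      rules; the second call then expands \<open>p\<close>.\<close>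
    by (simp add: linear_iff_linear_on linear_on_def[of scale UNIV] Omega_def mem_GL_Hom_iff
        scale_right_distrib del: p_add p_scale)
      (simp add: algebra_simps)
qed

lemma Omega_sum: "Omega p (\<sigma>, r) (x + y) = Omega p (\<sigma>, r) x + Omega p (\<sigma>, r) y"
  using linear_Omega by (simp add: Vector_Spaces.linear_iff)

lemma Omega_fix: "g \<in> \<gg> \<Longrightarrow> Omega p (\<sigma>, r) g = g"
  using mem by (simp add: Omega_def mem_GL_Hom_iff linear_on_zero[OF _ subspace_complement])

text \<open>As \<open>g\<close> is fixed, the right-hand bracket is
  \<open>[r x, g] + [\<sigma> x, g]\<close>, and only its second summand has to be split by
  \<open>p\<close>. The components in \<open>complement\<close> give (G1), those in
  \<open>\<gg>\<close> give (G2).\<close>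

lemma Omega_bracket_mixed_iff:
  assumes x: "x \<in> complement" and g: "g \<in> \<gg>"
  shows "Omega p (\<sigma>, r) (bracket x g) = bracket (Omega p (\<sigma>, r) x) (Omega p (\<sigma>, r) g) \<longleftrightarrow>
    \<sigma> (can_lharp bracket p x g) = can_lharp bracket p (\<sigma> x) g \<and>
    r (can_lharp bracket p x g) = bracket (r x) g + can_rharp bracket p (\<sigma> x - x) g"
proof -
  have "Omega p (\<sigma>, r) (bracket x g) =
      (p (bracket x g) + r (can_lharp bracket p x g)) + \<sigma> (can_lharp bracket p x g)"
    by (simp add: Omega_def can_lharp_def)
  moreover have "bracket (Omega p (\<sigma>, r) x) (Omega p (\<sigma>, r) g) =
      (bracket (r x) g + p (bracket (\<sigma> x) g)) + can_lharp bracket p (\<sigma> x) g"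
    using assms by (simp add: Omega_complement Omega_fix bracket_add_left can_lharp_def)
  ultimately have "Omega p (\<sigma>, r) (bracket x g) = bracket (Omega p (\<sigma>, r) x) (Omega p (\<sigma>, r) g)
    \<longleftrightarrow> p (bracket x g) + r (can_lharp bracket p x g) = bracket (r x) g + p (bracket (\<sigma> x) g)
      \<and> \<sigma> (can_lharp bracket p x g) = can_lharp bracket p (\<sigma> x) g"
    using assms by (simp add: components_eq_iff)
  \<comment> \<open>Moving \<open>p (bracket x g)\<close> to the other side produces the difference
    \<open>\<sigma> x - x\<close> of (G2).\<close>
  then show ?thesis
    by (auto simp: can_rharp_def bracket_diff_left algebra_simps)
qed

lemma Omega_bracket_complement_iff:
  assumes x: "x \<in> complement" and y: "y \<in> complement"
  shows "Omega p (\<sigma>, r) (bracket x y) = bracket (Omega p (\<sigma>, r) x) (Omega p (\<sigma>, r) y) \<longleftrightarrow>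
    \<sigma> (can_curly bracket p x y) = can_curly bracket p (\<sigma> x) (\<sigma> y)
      + can_lharp bracket p (\<sigma> x) (r y) - can_lharp bracket p (\<sigma> y) (r x) \<and>
    r (can_curly bracket p x y) = bracket (r x) (r y) + can_rharp bracket p (\<sigma> x) (r y)
      - can_rharp bracket p (\<sigma> y) (r x) + can_theta bracket p (\<sigma> x) (\<sigma> y) - can_theta bracket p x y"
    (is "_ \<longleftrightarrow> ?c = ?c' \<and> _ = ?d - _")
proof -
  have "Omega p (\<sigma>, r) (bracket x y) =
      (p (bracket x y) + r (can_curly bracket p x y)) + ?c"
    by (simp add: Omega_def can_curly_def)
  \<comment> \<open>Of the four brackets in the expansion, \<open>[r x, r y]\<close> lies in
    \<open>\<gg>\<close> and the others are split by \<open>p\<close>. Rewriting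
    \<open>[r x, \<sigma> y]\<close> as \<open>- [\<sigma> y, r x]\<close> accounts for the minus
    signs in (G3) and (G4).\<close>
  moreover have "bracket (Omega p (\<sigma>, r) x) (Omega p (\<sigma>, r) y) = ?d + ?c'"
    using assms bracket_antisym[of "r x" "\<sigma> y"]
    by (simp add: Omega_complement bracket_add_left bracket_add_right
        can_lharp_def can_rharp_def can_curly_def can_theta_def)
  moreover have "?c' \<in> complement" "?c \<in> complement" "?d \<in> \<gg>"
    "p (bracket x y) + r (can_curly bracket p x y) \<in> \<gg>"
    using assms
    by (auto simp: can_rharp_def can_theta_def
        intro!: subspace_add[OF subspace_complement] subspace_diff[OF subspace_complement])
  ultimately have "Omega p (\<sigma>, r) (bracket x y) = bracket (Omega p (\<sigma>, r) x) (Omega p (\<sigma>, r) y)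
    \<longleftrightarrow> p (bracket x y) + r (can_curly bracket p x y) = ?d \<and> ?c = ?c'"
    by (simp only: components_eq_iff)
  then show ?thesis
    by (auto simp: can_theta_def algebra_simps)
qed

text \<open>By bilinearity only pairs of components matter. On \<open>\<gg>\<close> both sides agree
  because \<open>\<gg>\<close> is fixed and closed under brackets, and the order
  \<open>\<gg>\<close>, \<open>complement\<close> reduces to the opposite one by
  antisymmetry.\<close>

lemma Omega_bracket_iff:
  "(\<forall>u v. Omega p (\<sigma>, r) (bracket u v) = bracket (Omega p (\<sigma>, r) u) (Omega p (\<sigma>, r) v)) \<longleftrightarrow>
    (\<forall>x\<in>complement. \<forall>g\<in>\<gg>.
      Omega p (\<sigma>, r) (bracket x g) = bracket (Omega p (\<sigma>, r) x) (Omega p (\<sigma>, r) g)) \<and>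
    (\<forall>x\<in>complement. \<forall>y\<in>complement.
      Omega p (\<sigma>, r) (bracket x y) = bracket (Omega p (\<sigma>, r) x) (Omega p (\<sigma>, r) y))"
    (is "?L \<longleftrightarrow> ?R")
proof
  assume R: ?R
  define f where "f = Omega p (\<sigma>, r)"
  have f_add: "f (a + b) = f a + f b" for a b
    by (simp add: f_def Omega_sum)
  have f_neg: "f (- a) = - f a" for a
    using f_add[of a "- a"] f_add[of 0 0] by (simp add: eq_neg_iff_add_eq_0 add.commute)
  have gg: "f (bracket a b) = bracket (f a) (f b)" if "a \<in> \<gg>" "b \<in> \<gg>" for a b
    using that by (simp add: f_def Omega_fix)
  have Vg: "f (bracket x a) = bracket (f x) (f a)" if "x \<in> complement" "a \<in> \<gg>" for x a
    using that R by (simp add: f_def)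
  have VV: "f (bracket x y) = bracket (f x) (f y)" if "x \<in> complement" "y \<in> complement" for x y
    using that R by (simp add: f_def)
  have gV: "f (bracket a x) = bracket (f a) (f x)" if "a \<in> \<gg>" "x \<in> complement" for a x
    using Vg[OF that(2,1)] by (simp add: f_neg bracket_antisym[of a x] bracket_antisym[of "f a" "f x"])
  have "f (bracket u v) = bracket (f u) (f v)" for u v
  proof -
    have "f (bracket (p u + (u - p u)) (p v + (v - p v))) =
        bracket (f (p u + (u - p u))) (f (p v + (v - p v)))"
      unfolding bracket_add_left bracket_add_right f_add
      by (simp only: gg gV Vg VV p_mem minus_p_mem)
    then show ?thesis by simp
  qed
  then show ?L by (simp add: f_def)
qed simp

end

section \<open>The extending group and the multiplicativity of \<open>Omega\<close>\<close>

abbreviation "extending \<equiv> extending_group scale bracket \<gg> complement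
  (can_lharp bracket p) (can_rharp bracket p) (can_theta bracket p) (can_curly bracket p)"

lemma mem_extending_iff:
  "s \<in> carrier extending \<longleftrightarrow> s \<in> carrier (GL_Hom scale complement \<gg>) \<and>
     (\<forall>u v. Omega p s (bracket u v) = bracket (Omega p s u) (Omega p s v))"
proof (cases s)
  case (Pair \<sigma> r)
  show ?thesis
  proof (cases "s \<in> carrier (GL_Hom scale complement \<gg>)")
    case True
    then have mem: "(\<sigma>, r) \<in> carrier (GL_Hom scale complement \<gg>)"
      by (simp add: Pair)
    then have "(\<sigma>, r) \<in> carrier (GL_group scale complement) \<times> carrier (Hom_group scale complement \<gg>)"
      by (simp add: GL_Hom_def right_semidirect_def)
    then show ?thesis
      unfolding Pair Omega_bracket_iff[OF mem]
      by (auto simp: mem extending_group_def Omega_bracket_mixed_iff[OF mem]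
          Omega_bracket_complement_iff[OF mem])
  next
    case False
    then show ?thesis
      by (auto simp: Pair extending_group_def GL_Hom_def right_semidirect_def)
  qed
qed

text \<open>Put \<open>v = u - p u\<close>. The value \<open>Omega p t u\<close> has components
  \<open>p u + q v\<close> and \<open>\<tau> v\<close>, so applying \<open>Omega p s\<close> adds
  \<open>r (\<tau> v)\<close> to the first: exactly the twisted sum in the semidirect
  product.\<close>

lemma Omega_mult:
  assumes "s \<in> carrier (GL_Hom scale complement \<gg>)" "t \<in> carrier (GL_Hom scale complement \<gg>)"
  shows "Omega p (s \<otimes>\<^bsub>GL_Hom scale complement \<gg>\<^esub> t) = Omega p s \<circ> Omega p t"
proof (cases s, cases t)
  fix \<sigma> r \<tau> q
  assume eq: "s = (\<sigma>, r)" "t = (\<tau>, q)"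
  note [simp] = sigma_mem[OF assms(2)[unfolded eq]] r_mem[OF assms(2)[unfolded eq]]
  show ?thesis
  proof
    fix u
    have "Omega p s (Omega p t u) = Omega p s ((p u + q (u - p u)) + \<tau> (u - p u))"
      by (simp add: eq Omega_def)
    also have "\<dots> = (p u + q (u - p u)) + r (\<tau> (u - p u)) + \<sigma> (\<tau> (u - p u))"
      unfolding eq by (rule Omega_add) simp_all
    also have "\<dots> = Omega p (s \<otimes>\<^bsub>GL_Hom scale complement \<gg>\<^esub> t) u"
      using mult_GL_Hom[of \<sigma> r \<tau> q] assms
      by (simp add: eq Omega_def compose_eq algebra_simps)
    finally show "Omega p (s \<otimes>\<^bsub>GL_Hom scale complement \<gg>\<^esub> t) u = (Omega p s \<circ> Omega p t) u"
      by simp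
  qed
qed

lemma Omega_one: "Omega p \<one>\<^bsub>GL_Hom scale complement \<gg>\<^esub> = id"
  by (rule ext)
    (simp add: Omega_def GL_Hom_def right_semidirect_def GL_group_def Hom_group_def BijGroup_def)

text \<open>Multiplicativity turns the group inverse of \<open>s\<close> into a two-sided inverse
  function.\<close>

lemma bij_Omega:
  assumes "s \<in> carrier (GL_Hom scale complement \<gg>)"
  shows "bij (Omega p s)"
proof -
  interpret S: group "GL_Hom scale complement \<gg>" by (rule group_semidirect)
  show ?thesis
    using Omega_mult[of s "inv\<^bsub>GL_Hom scale complement \<gg>\<^esub> s"]
      Omega_mult[of "inv\<^bsub>GL_Hom scale complement \<gg>\<^esub> s" s] assms Omega_one
    by (intro o_bij[of "Omega p (inv\<^bsub>GL_Hom scale complement \<gg>\<^esub> s)"]) simp_all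
qed

text \<open>The target consists of all bijections, since for a general pair the image need not
  respect the bracket.\<close>

lemma Omega_hom: "Omega p \<in> hom (GL_Hom scale complement \<gg>) (BijGroup UNIV)"
  by (rule homI)
    (auto simp: BijGroup_def Bij_UNIV bij_Omega Omega_mult compose_def)

text \<open>On \<open>complement\<close> the components of \<open>Omega p (\<sigma>, r) x\<close>
  are \<open>r x\<close> and \<open>\<sigma> x\<close>; elsewhere both maps are
  \<open>undefined\<close> by extensionality.\<close>

lemma inj_on_Omega: "inj_on (Omega p) (carrier (GL_Hom scale complement \<gg>))"
proof (rule inj_onI)
  fix s t
  assume s: "s \<in> carrier (GL_Hom scale complement \<gg>)" and t: "t \<in> carrier (GL_Hom scale complement \<gg>)"
    and eq: "Omega p s = Omega p t"
  obtain \<sigma> r \<tau> q where st: "s = (\<sigma>, r)" "t = (\<tau>, q)"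
    by (cases s, cases t)
  have "r x = q x \<and> \<sigma> x = \<tau> x" if "x \<in> complement" for x
  proof -
    have "r x + \<sigma> x = q x + \<tau> x"
      using fun_cong[OF eq, of x] s t that unfolding st by (simp add: Omega_complement)
    then show ?thesis
      using s t that unfolding st by (simp add: components_eq_iff r_mem sigma_mem)
  qed
  moreover have "\<sigma> \<in> extensional complement" "\<tau> \<in> extensional complement"
    "r \<in> extensional complement" "q \<in> extensional complement"
    using s t by (auto simp: st mem_GL_Hom_iff Bij_def PiE_def)
  ultimately show "s = t"
    unfolding st by (auto intro: extensionalityI)
qed

text \<open>Linearity, bijectivity and fixing \<open>\<gg>\<close> hold for every pair, which leaves
  the bracket condition of \<open>mem_extending_iff\<close>.\<close>

lemma Omega_mem_Gal_iff:
  assumes "s \<in> carrier (GL_Hom scale complement \<gg>)"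
  shows "Omega p s \<in> carrier (Gal scale bracket \<gg>) \<longleftrightarrow> s \<in> carrier extending"
  using assms
  by (cases s) (auto simp: mem_extending_iff Gal_def lie_automorphism_def linear_Omega bij_Omega
      Omega_fix)

section \<open>Recovering a pair from a Galois automorphism\<close>

lemma Gal_linear:
  assumes "f \<in> carrier (Gal scale bracket \<gg>)"
  shows "f (x + y) = f x + f y" "f (x - y) = f x - f y" "f (scale c x) = scale c (f x)"
    "g \<in> \<gg> \<Longrightarrow> f g = g"
proof -
  have lin: "Vector_Spaces.linear scale scale f"
    using assms by (simp add: Gal_def lie_automorphism_def)
  then show add: "f (x + y) = f x + f y" and "f (scale c x) = scale c (f x)" for x y c
    by (simp_all add: Vector_Spaces.linear_iff)
  show "f (x - y) = f x - f y"
    using add[of "x - y" y] by (simp add: algebra_simps)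
  show "g \<in> \<gg> \<Longrightarrow> f g = g"
    using assms by (simp add: Gal_def)
qed

lemma Gal_subset_Omega_image:
  assumes f: "f \<in> carrier (Gal scale bracket \<gg>)"
  shows "\<exists>s\<in>carrier (GL_Hom scale complement \<gg>). Omega p s = f"
proof -
  interpret Gal: group "Gal scale bracket \<gg>" by (rule group_Gal)
  \<comment> \<open>The inverse is taken inside the Galois group, so that it too is linear and fixes
    \<open>\<gg>\<close>.\<close>
  define f' where "f' = inv\<^bsub>Gal scale bracket \<gg>\<^esub> f"
  have f': "f' \<in> carrier (Gal scale bracket \<gg>)"
    using f by (simp add: f'_def)
  have comp: "a \<otimes>\<^bsub>Gal scale bracket \<gg>\<^esub> b = a \<circ> b"
    if "a \<in> carrier (Gal scale bracket \<gg>)" "b \<in> carrier (Gal scale bracket \<gg>)" for a b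
    using that
    by (auto simp: Gal_def mult_BijGroup Bij_UNIV lie_automorphism_def compose_def)
  have one: "\<one>\<^bsub>Gal scale bracket \<gg>\<^esub> = id"
    by (auto simp: Gal_def BijGroup_def)
  have ff': "f (f' u) = u" and f'f: "f' (f u) = u" for u
    using comp[OF f f'] comp[OF f' f] f one by (simp_all add: f'_def fun_eq_iff)
  define \<sigma> where "\<sigma> = (\<lambda>x\<in>complement. f x - p (f x))"
  define r where "r = (\<lambda>x\<in>complement. p (f x))"
  \<comment> \<open>The same construction applied to \<open>f'\<close> inverts
    \<open>\<sigma>\<close>: the correction \<open>p (f x)\<close> lies in \<open>\<gg>\<close>, is
    fixed by \<open>f'\<close>, and is removed again by subtracting the
    \<open>\<gg>\<close>-component.\<close>
  have "bij_betw \<sigma> complement complement"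
    by (rule bij_betw_byWitness[where f' = "\<lambda>x. f' x - p (f' x)"])
      (auto simp: \<sigma>_def Gal_linear[OF f] Gal_linear[OF f'] ff' f'f)
  then have "(\<sigma>, r) \<in> carrier (GL_Hom scale complement \<gg>)"
    using subspace_complement
    by (auto simp: mem_GL_Hom_iff Bij_def \<sigma>_def r_def linear_on_def subspace_add subspace_scale
        Gal_linear[OF f] scale_right_diff_distrib)
  moreover have "Omega p (\<sigma>, r) = f"
    by (rule ext) (simp add: Omega_def \<sigma>_def r_def Gal_linear[OF f])
  ultimately show ?thesis by blast
qed

section \<open>The isomorphism and the embedding\<close>

lemma subgroup_extending: "subgroup (carrier extending) (GL_Hom scale complement \<gg>)"
proof -
  interpret group_hom "GL_Hom scale complement \<gg>" "BijGroup UNIV" "Omega p"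
    by (simp add: group_hom_def group_hom_axioms_def group_semidirect group_BijGroup Omega_hom)
  have "subgroup (carrier (Gal scale bracket \<gg>)) (BijGroup UNIV)"
    using subgroup_Gal by (simp add: Gal_def)
  then have "subgroup {s \<in> carrier (GL_Hom scale complement \<gg>).
      Omega p s \<in> carrier (Gal scale bracket \<gg>)} (GL_Hom scale complement \<gg>)"
    by (rule subgroup_preimage)
  also have "{s \<in> carrier (GL_Hom scale complement \<gg>). Omega p s \<in> carrier (Gal scale bracket \<gg>)} =
      carrier extending"
    using Omega_mem_Gal_iff mem_extending_iff by auto
  finally show ?thesis .
qed

lemma extending_eq: "extending = (GL_Hom scale complement \<gg>)\<lparr>carrier := carrier extending\<rparr>"
  by (simp add: extending_group_def)

lemma group_extending: "group extending"
  using subgroup.subgroup_is_group[OF subgroup_extending group_semidirect] extending_eq by simp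

lemma Omega_iso: "Omega p \<in> iso extending (Gal scale bracket \<gg>)"
proof -
  have sub: "carrier extending \<subseteq> carrier (GL_Hom scale complement \<gg>)"
    using mem_extending_iff by blast
  have Gal: "Omega p s \<in> carrier (Gal scale bracket \<gg>)" if "s \<in> carrier extending" for s
    using that sub Omega_mem_Gal_iff by blast
  have "Omega p \<in> hom extending (Gal scale bracket \<gg>)"
  proof (rule homI[OF Gal])
    fix s t
    assume "s \<in> carrier extending" "t \<in> carrier extending"
    then have "Omega p (s \<otimes>\<^bsub>GL_Hom scale complement \<gg>\<^esub> t) = Omega p s \<otimes>\<^bsub>BijGroup UNIV\<^esub> Omega p t"
      using hom_mult[OF Omega_hom] sub by blast
    then show "Omega p (s \<otimes>\<^bsub>extending\<^esub> t) = Omega p s \<otimes>\<^bsub>Gal scale bracket \<gg>\<^esub> Omega p t"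
      by (simp add: extending_group_def Gal_def)
  qed
  \<comment> \<open>A preimage is first found in the whole semidirect product; having its image in
    the Galois group forces it into \<open>extending\<close>.\<close>
  moreover have "carrier (Gal scale bracket \<gg>) \<subseteq> Omega p ` carrier extending"
    using Gal_subset_Omega_image Omega_mem_Gal_iff by blast
  then have "Omega p ` carrier extending = carrier (Gal scale bracket \<gg>)"
    using Gal by blast
  ultimately show ?thesis
    using inj_on_subset[OF inj_on_Omega sub] by (simp add: iso_def bij_betw_def)
qed

lemma Gal_embedding:
  "inv_into (carrier extending) (Omega p) \<in> mon (Gal scale bracket \<gg>) (GL_Hom scale complement \<gg>)"
proof -
  have "inv_into (carrier extending) (Omega p) \<in> mon (Gal scale bracket \<gg>) extending"
    using group.iso_set_sym[OF group_extending Omega_iso] by (simp add: iso_iff_mon_epi)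
  \<comment> \<open>The identity serves as the inclusion of the subgroup; composing it with the
    inverse of \<open>Omega p\<close> gives the embedding.\<close>
  moreover have "id \<in> mon extending (GL_Hom scale complement \<gg>)"
    using mem_extending_iff by (auto simp: mon_def hom_def extending_group_def GL_Hom_def right_semidirect_def)
  ultimately show ?thesis
    using mon_compose by fastforce
qed

end

theorem theorem3p2:
  fixes scale :: "'k::field \<Rightarrow> 'h::ab_group_add \<Rightarrow> 'h"
    and bracket :: "'h \<Rightarrow> 'h \<Rightarrow> 'h"
    and \<gg> V :: "'h set"
    and p :: "'h \<Rightarrow> 'h"
    and \<G> \<S> :: "(('h \<Rightarrow> 'h) \<times> ('h \<Rightarrow> 'h)) monoid"
  assumes "lie_algebra scale bracket"
    and "lie_subalgebra scale bracket \<gg>"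
    and "linear_retraction scale \<gg> p"
    and V: "V = {x. p x = 0}"
    and S: "\<S> = GL_Hom scale V \<gg>"
    and G: "\<G> = extending_group scale bracket \<gg> V
              (can_lharp bracket p) (can_rharp bracket p) (can_theta bracket p) (can_curly bracket p)"
  shows "group \<S> \<and> subgroup (carrier \<G>) \<S> \<and> group \<G> \<and> group (Gal scale bracket \<gg>)
    \<and> (\<forall>(\<sigma>, r)\<in>carrier \<G>. \<forall>g\<in>\<gg>. \<forall>x\<in>V. Omega p (\<sigma>, r) (g + x) = g + r x + \<sigma> x)
    \<and> Omega p \<in> iso \<G> (Gal scale bracket \<gg>)
    \<and> (\<exists>\<Phi>. \<Phi> \<in> mon (Gal scale bracket \<gg>) \<S>)"
proof -
  interpret retracted_lie_extension scale bracket \<gg> p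
    using assms(1-3) by (intro retracted_lie_extension.intro retracted_lie_extension_axioms.intro)
  have V': "V = complement"
    unfolding V complement_def ..
  show ?thesis
    unfolding S G V'
  proof (intro conjI exI)
    show "\<forall>(\<sigma>, r)\<in>carrier extending. \<forall>g\<in>\<gg>. \<forall>x\<in>complement.
        Omega p (\<sigma>, r) (g + x) = g + r x + \<sigma> x"
      using Omega_add by blast
    show "group (GL_Hom scale complement \<gg>)" by (rule group_semidirect)
    show "subgroup (carrier extending) (GL_Hom scale complement \<gg>)" by (rule subgroup_extending)
    show "group extending" by (rule group_extending)
    show "group (Gal scale bracket \<gg>)" by (rule group_Gal)
    show "Omega p \<in> iso extending (Gal scale bracket \<gg>)" by (rule Omega_iso)
    show "inv_into (carrier extending) (Omega p)
        \<in> mon (Gal scale bracket \<gg>) (GL_Hom scale complement \<gg>)"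
      by (rule Gal_embedding)
  qed
qed

end
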